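(* A function $h:[0,1]\times S^{n-1}\to\mathbb{R}$ is the support function of a (unique) fuzzy vector $u:\mathbb{R}^n\to[0,1]$, given by $$u(t)=\sup\{\alpha\in[0,1]\mid \langle t,x\rangle\leq h(\alpha,x)\ \text{for all}\ x\in S^{n-1}\},$$ if, and only if, the following two conditions hold: (VS1) $h(\alpha,-):S^{n-1}\to\mathbb{R}$ is sublinear for each $\alpha\in[0,1]$, i.e., $$h(\alpha,x)+h(\alpha,-x)\geq 0$$ and $$h\left(\alpha,\frac{\lambda x+(1-\lambda)y}{\|\lambda x+(1-\lambda)y\|}\right)\leq\frac{\lambda h(\alpha,x)+(1-\lambda)h(\alpha,y)}{\|\lambda x+(1-\lambda)y\|}$$ for all $\alpha\in[0,1]$, $x,y\in S^{n-1}$, $\lambda\in[0,1]$ with $\lambda x+(1-\lambda)y\neq 0$; (VS2) for each $x\in S^{n-1}$, the function $h(-,x):[0,1]\to\mathbb{R}$ is non-increasing, left-continuous on $(0,1]$ and right-continuous at $0$.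
   Context: Let $n\geq 1$; $\langle-,-\rangle$ and $\|\cdot\|$ are the standard Euclidean inner product and norm on $\mathbb{R}^n$, and $S^{n-1}$ is the unit sphere. A fuzzy vector (of dimension $n$) is a function $u:\mathbb{R}^n\to[0,1]$ such that: (V1) there is $t_0\in\mathbb{R}^n$ with $u(t_0)=1$; (V2) the closure of $\{t\in\mathbb{R}^n\mid u(t)>0\}$ is compact; (V3) $\min(u(s),u(t))\leq u(\lambda s+(1-\lambda)t)$ for all $s,t\in\mathbb{R}^n$ and $\lambda\in[0,1]$; (V4) $\{t\in\mathbb{R}^n\mid u(t)\geq\alpha\}$ is closed for all $\alpha\in[0,1]$. Its level sets are $u_\alpha=\{t\in\mathbb{R}^n\mid u(t)\geq\alpha\}$ for $\alpha\in(0,1]$, and $u_0=\overline{\{t\in\mathbb{R}^n\mid u(t)>0\}}$. The support function of a fuzzy vector $u$ is $h_u:[0,1]\times S^{n-1}\to\mathbb{R}$, $h_u(\alpha,x):=\sup_{t\in u_\alpha}\langle t,x\rangle$. Suprema of sets of levels $\alpha$ are computed in $[0,1]$, so the supremum of the empty set is $0$. *)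

theory Defs
  imports "HOL-Analysis.Analysis"
begin

definition fuzzy_vector :: "(real ^ 'n \<Rightarrow> real) \<Rightarrow> bool" where
  "fuzzy_vector u \<longleftrightarrow>
     (\<forall>t. u t \<in> {0..1}) \<and>
     (\<exists>t. u t = 1) \<and>
     compact (closure {t. u t > 0}) \<and>
     (\<forall>s t. \<forall>c\<in>{0..1}. min (u s) (u t) \<le> u (c *\<^sub>R s + (1 - c) *\<^sub>R t)) \<and>
     (\<forall>\<alpha>\<in>{0..1}. closed {t. u t \<ge> \<alpha>})"

definition level_set :: "(real ^ 'n \<Rightarrow> real) \<Rightarrow> real \<Rightarrow> (real ^ 'n) set" where
  "level_set u \<alpha> = (if \<alpha> = 0 then closure {t. u t > 0} else {t. u t \<ge> \<alpha>})"

text \<open>Meaningful for levels in \<open>[0,1]\<close> and unit vectors only. For a fuzzy vector, the level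
  sets at these levels are nonempty and compact, so the supremum is a genuine one.\<close>

definition support_function :: "(real ^ 'n \<Rightarrow> real) \<Rightarrow> real \<Rightarrow> real ^ 'n \<Rightarrow> real" where
  "support_function u \<alpha> x = (SUP t \<in> level_set u \<alpha>. t \<bullet> x)"

text \<open>A function on \<open>[0,1] \<times> S\<^sup>n\<^sup>-\<^sup>1\<close> is represented by a total curried function, whose values
  outside that domain are never constrained or used.\<close>

definition is_support_function_of ::
    "(real \<Rightarrow> real ^ 'n \<Rightarrow> real) \<Rightarrow> (real ^ 'n \<Rightarrow> real) \<Rightarrow> bool" where
  "is_support_function_of h u \<longleftrightarrow>
     (\<forall>\<alpha>\<in>{0..1}. \<forall>x\<in>sphere 0 1. h \<alpha> x = support_function u \<alpha> x)"

text \<open>The supremum in the complete lattice \<open>[0,1]\<close>: on type \<^typ>\<open>real\<close>, \<open>Sup {}\<close> is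
  unspecified, whereas here it has to be \<open>0\<close>.\<close>

definition level_Sup :: "real set \<Rightarrow> real" where
  "level_Sup A = (if A = {} then 0 else Sup A)"

definition induced_fuzzy_vector :: "(real \<Rightarrow> real ^ 'n \<Rightarrow> real) \<Rightarrow> real ^ 'n \<Rightarrow> real" where
  "induced_fuzzy_vector h t = level_Sup {\<alpha> \<in> {0..1}. \<forall>x\<in>sphere 0 1. t \<bullet> x \<le> h \<alpha> x}"

definition sublinear_on_sphere :: "(real ^ 'n \<Rightarrow> real) \<Rightarrow> bool" where
  "sublinear_on_sphere g \<longleftrightarrow>
     (\<forall>x\<in>sphere 0 1. g x + g (- x) \<ge> 0) \<and>
     (\<forall>x\<in>sphere 0 1. \<forall>y\<in>sphere 0 1. \<forall>c\<in>{0..1}.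
        c *\<^sub>R x + (1 - c) *\<^sub>R y \<noteq> 0 \<longrightarrow>
        g ((c *\<^sub>R x + (1 - c) *\<^sub>R y) /\<^sub>R norm (c *\<^sub>R x + (1 - c) *\<^sub>R y))
          \<le> (c * g x + (1 - c) * g y) / norm (c *\<^sub>R x + (1 - c) *\<^sub>R y))"

definition VS1 :: "(real \<Rightarrow> real ^ 'n \<Rightarrow> real) \<Rightarrow> bool" where
  "VS1 h \<longleftrightarrow> (\<forall>\<alpha>\<in>{0..1}. sublinear_on_sphere (h \<alpha>))"

definition VS2 :: "(real \<Rightarrow> real ^ 'n \<Rightarrow> real) \<Rightarrow> bool" where
  "VS2 h \<longleftrightarrow>
     (\<forall>x\<in>sphere 0 1.
        antimono_on {0..1} (\<lambda>\<alpha>. h \<alpha> x) \<and>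
        (\<forall>\<alpha>\<in>{0<..1}. continuous (at_left \<alpha>) (\<lambda>\<beta>. h \<beta> x)) \<and>
        continuous (at_right 0) (\<lambda>\<beta>. h \<beta> x))"

end

theory Submission
  imports Defs
begin

text \<open>Two dual descriptions of a convex body are at work. A nonempty compact convex set is the
  intersection of its supporting half-spaces, hence is recovered from its support function \<open>g\<close> as
  the set \<open>wulff_shape g\<close> of all \<open>t\<close> with \<open>t \<bullet> x \<le> g x\<close> for every unit vector \<open>x\<close>
  (\<open>wulff_shape_support\<close>). Conversely a function \<open>g\<close> that is sublinear on the sphere is the support
  function of \<open>wulff_shape g\<close> (\<open>support_wulff_shape\<close>). This is a finite-dimensional Hahn-Banach
  statement: the positively homogeneous extension of \<open>g\<close> is convex, and any subgradient of it at a
  unit vector \<open>x\<close> is a point of the Wulff shape at which the bound \<open>g x\<close> is attained.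

  A fuzzy vector \<open>u\<close> amounts to a decreasing family of nonempty compact convex level sets. The
  compatibility between levels is exactly one-sided continuity: for \<open>\<alpha> > 0\<close> the level set at \<open>\<alpha>\<close> is
  the intersection of those below \<open>\<alpha>\<close>, which by compactness makes the support function
  left-continuous, and level \<open>0\<close> is the closure of the union of the others, which makes it
  right-continuous at \<open>0\<close>. Since \<open>u t\<close> is the supremum of the levels whose level set contains \<open>t\<close>,
  and these level sets are Wulff shapes, \<open>u\<close> is given by the stated formula and is therefore unique.

  In the other direction, VS1 and VS2 make the sets \<open>wulff_shape (h \<alpha>)\<close> nonempty, compact, convex
  and decreasing in \<open>\<alpha>\<close>. Left continuity identifies them, for \<open>\<alpha> > 0\<close>, with the level sets of the
  induced function (\<open>le_induced_fuzzy_vector_iff\<close>), which gives the right support function at these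
  levels. At level \<open>0\<close> both \<open>h\<close> and the support function of the induced fuzzy vector are
  right-continuous, so they agree there as well.\<close>

section \<open>Support functions of convex bodies\<close>

text \<open>The largest set whose support function is at most \<open>g\<close>, known as the Wulff shape of \<open>g\<close>.\<close>

definition wulff_shape :: "('a::euclidean_space \<Rightarrow> real) \<Rightarrow> 'a set" where
  "wulff_shape g = {t. \<forall>x\<in>sphere 0 1. t \<bullet> x \<le> g x}"

lemma wulff_shapeI: "(\<And>x. norm x = 1 \<Longrightarrow> t \<bullet> x \<le> g x) \<Longrightarrow> t \<in> wulff_shape g"
  by (simp add: wulff_shape_def)

lemma wulff_shapeD: "t \<in> wulff_shape g \<Longrightarrow> norm x = 1 \<Longrightarrow> t \<bullet> x \<le> g x"
  by (simp add: wulff_shape_def)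

lemma wulff_shape_eq_Inter: "wulff_shape g = (\<Inter>x\<in>sphere 0 1. {t. x \<bullet> t \<le> g x})"
  by (auto simp: wulff_shape_def inner_commute)

lemma closed_wulff_shape: "closed (wulff_shape g)"
  unfolding wulff_shape_eq_Inter by (intro closed_INT ballI closed_halfspace_le)

lemma convex_wulff_shape: "convex (wulff_shape g)"
  unfolding wulff_shape_eq_Inter by (intro convex_INT convex_halfspace_le)

text \<open>The inequalities for the unit vectors \<open>b\<close> and \<open>- b\<close>, with \<open>b\<close> in the basis, already confine
  the set to a box.\<close>

lemma bounded_wulff_shape: "bounded (wulff_shape g)"
  unfolding bounded_iff
proof (intro exI ballI)
  fix t assume t: "t \<in> wulff_shape g"
  have "\<bar>t \<bullet> b\<bar> \<le> \<bar>g b\<bar> + \<bar>g (- b)\<bar>" if "b \<in> Basis" for b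
    using wulff_shapeD[OF t, of b] wulff_shapeD[OF t, of "- b"] that by auto
  then show "norm t \<le> (\<Sum>b\<in>Basis. \<bar>g b\<bar> + \<bar>g (- b)\<bar>)"
    by (intro order_trans[OF norm_le_l1] sum_mono)
qed

lemma bdd_above_inner_image:
  fixes K :: "'a::euclidean_space set"
  assumes "bounded K"
  shows "bdd_above ((\<lambda>t. t \<bullet> x) ` K)"
proof -
  obtain B where "\<And>t. t \<in> K \<Longrightarrow> norm t \<le> B"
    using assms by (auto simp: bounded_iff)
  then have "t \<bullet> x \<le> B * norm x" if "t \<in> K" for t
    using that by (meson mult_right_mono norm_cauchy_schwarz norm_ge_zero order_trans)
  then show ?thesis by (intro bdd_aboveI2[where M = "B * norm x"])
qed

text \<open>A point outside \<open>K\<close> is strictly separated from \<open>K\<close> by a hyperplane, and the unit normal of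
  this hyperplane, pointing away from \<open>K\<close>, is a direction in which the point violates its inequality.\<close>

lemma wulff_shape_support:
  fixes K :: "'a::euclidean_space set"
  assumes "closed K" "convex K" "bounded K" "K \<noteq> {}"
    and g: "\<And>x. norm x = 1 \<Longrightarrow> g x = (SUP t\<in>K. t \<bullet> x)"
  shows "wulff_shape g = K"
proof (intro set_eqI iffI)
  fix t assume "t \<in> K"
  then show "t \<in> wulff_shape g"
    using assms(3) by (auto intro!: wulff_shapeI cSUP_upper bdd_above_inner_image simp: g)
next
  fix t assume t: "t \<in> wulff_shape g"
  show "t \<in> K"
  proof (rule ccontr)
    assume "t \<notin> K"
    then obtain a b where ab: "a \<bullet> t < b" "\<And>s. s \<in> K \<Longrightarrow> b < a \<bullet> s"
      using separating_hyperplane_closed_point[OF assms(2,1)] by metis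
    have "a \<noteq> 0" using ab \<open>K \<noteq> {}\<close> by fastforce
    define x where "x = - (a /\<^sub>R norm a)"
    have x: "norm x = 1" using \<open>a \<noteq> 0\<close> by (simp add: x_def)
    have sx: "s \<bullet> x = - (a \<bullet> s) / norm a" for s
      by (simp add: x_def inner_commute divide_inverse)
    have "(SUP s\<in>K. s \<bullet> x) \<le> - b / norm a"
    proof (rule cSUP_least[OF \<open>K \<noteq> {}\<close>])
      show "s \<bullet> x \<le> - b / norm a" if "s \<in> K" for s
        unfolding sx using ab(2)[OF that] by (intro divide_right_mono) auto
    qed
    also have "- b / norm a < t \<bullet> x"
      using ab(1) \<open>a \<noteq> 0\<close> by (simp add: sx divide_strict_right_mono)
    also have "t \<bullet> x \<le> (SUP s\<in>K. s \<bullet> x)"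
      using wulff_shapeD[OF t x] by (simp add: g x)
    finally show False by simp
  qed
qed

text \<open>A supremum of linear functions is sublinear; dividing by the norm of the combined vector
  expresses this on the sphere. Nonemptiness of \<open>K\<close> gives \<open>g x + g (- x) \<ge> 0\<close>, since a point
  \<open>t\<close> of \<open>K\<close> contributes \<open>t \<bullet> x\<close> and \<open>- (t \<bullet> x)\<close>.\<close>

lemma sublinear_on_sphere_support:
  fixes K :: "(real ^ 'n) set"
  assumes "bounded K" "K \<noteq> {}"
    and g: "\<And>x. norm x = 1 \<Longrightarrow> g x = (SUP t\<in>K. t \<bullet> x)"
  shows "sublinear_on_sphere g"
proof -
  have ub: "t \<bullet> x \<le> g x" if "t \<in> K" "norm x = 1" for t x
    using that by (auto simp: g intro!: cSUP_upper bdd_above_inner_image assms(1))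
  show ?thesis
    unfolding sublinear_on_sphere_def
  proof (intro conjI ballI impI)
    fix x :: "real ^ 'n" assume "x \<in> sphere 0 1"
    moreover obtain t where "t \<in> K" using assms(2) by blast
    ultimately show "g x + g (- x) \<ge> 0"
      using ub[of t x] ub[of t "- x"] by simp
  next
    fix x y :: "real ^ 'n" and c :: real
    assume xy: "x \<in> sphere 0 1" "y \<in> sphere 0 1" and c: "c \<in> {0..1}"
    let ?z = "c *\<^sub>R x + (1 - c) *\<^sub>R y"
    assume "?z \<noteq> 0"
    then have z: "norm (?z /\<^sub>R norm ?z) = 1" by simp
    have "t \<bullet> (?z /\<^sub>R norm ?z) \<le> (c * g x + (1 - c) * g y) / norm ?z" if "t \<in> K" for t
    proof -
      have "t \<bullet> ?z \<le> c * g x + (1 - c) * g y"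
        using xy c ub[OF that, of x] ub[OF that, of y]
        by (simp add: inner_add_right add_mono mult_left_mono)
      then have "(t \<bullet> ?z) / norm ?z \<le> (c * g x + (1 - c) * g y) / norm ?z"
        by (rule divide_right_mono) simp
      then show ?thesis by (simp add: divide_inverse mult.commute)
    qed
    then show "g (?z /\<^sub>R norm ?z) \<le> (c * g x + (1 - c) * g y) / norm ?z"
      using g[OF z] assms(2) by (simp add: cSUP_least)
  qed
qed

section \<open>Sublinear functions are support functions\<close>

text \<open>The epigraph of \<open>f\<close> is separated from the open vertical ray below the point \<open>(x, f x)\<close>. The
  separating hyperplane cannot be vertical, because \<open>f\<close> is finite on the whole space, so it is the
  graph of an affine function, whose slope is the subgradient.\<close>

lemma convex_on_imp_subgradient:
  fixes f :: "'a::euclidean_space \<Rightarrow> real"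
  assumes "convex_on UNIV f"
  obtains t where "\<And>y. f x + t \<bullet> (y - x) \<le> f y"
proof -
  have "convex (epigraph UNIV f)" "convex ({x} \<times> {..<f x})"
    using assms by (auto simp: convex_epigraph intro!: convex_Times)
  moreover have "epigraph UNIV f \<noteq> {}" "{x} \<times> {..<f x} \<noteq> {}"
    "({x} \<times> {..<f x}) \<inter> epigraph UNIV f = {}"
    by (auto simp: epigraph_def)
  ultimately obtain a b where "a \<noteq> 0"
    and below: "\<forall>z\<in>{x} \<times> {..<f x}. a \<bullet> z \<le> b" and above: "\<forall>z\<in>epigraph UNIV f. b \<le> a \<bullet> z"
    using separating_hyperplane_sets[of "{x} \<times> {..<f x}" "epigraph UNIV f"] by blast
  obtain p q where a: "a = (p, q)" by (cases a)
  have sep: "p \<bullet> x + q * r \<le> p \<bullet> y + q * s" if "r < f x" "f y \<le> s" for r s y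
  proof -
    have "a \<bullet> (x, r) \<le> b" "b \<le> a \<bullet> (y, s)"
      using below above that by (auto simp: epigraph_def)
    then show ?thesis by (simp add: a)
  qed
  \<comment> \<open>The epigraph is unbounded upwards only, which fixes the sign of the vertical component.\<close>
  have "q \<ge> 0" using sep[of "f x - 1" x "f x"] by (simp add: algebra_simps)
  moreover have "q \<noteq> 0"
  proof
    assume "q = 0"
    then have "p \<bullet> p \<le> 0"
      using sep[of "f x - 1" "x - p" "f (x - p)"] by (simp add: inner_diff_right)
    then have "p = 0" by (metis inner_ge_zero inner_eq_zero_iff order_antisym)
    then show False using \<open>a \<noteq> 0\<close> \<open>q = 0\<close> by (simp add: a zero_prod_def)
  qed
  ultimately have "q > 0" by simp
  have "f x + (- (p /\<^sub>R q)) \<bullet> (y - x) \<le> f y" for y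
  proof -
    have "f x \<le> (p \<bullet> y - p \<bullet> x) / q + f y"
    proof (rule dense_le)
      fix r assume "r < f x"
      then have "p \<bullet> x + q * r \<le> p \<bullet> y + q * f y" by (rule sep) simp
      then show "r \<le> (p \<bullet> y - p \<bullet> x) / q + f y"
        using \<open>q > 0\<close> by (simp add: field_simps)
    qed
    then show ?thesis
      by (simp add: inner_diff_right divide_inverse algebra_simps)
  qed
  then show thesis by (rule that)
qed

definition homogeneous_extension :: "('a::euclidean_space \<Rightarrow> real) \<Rightarrow> 'a \<Rightarrow> real" where
  "homogeneous_extension g v = norm v * g (v /\<^sub>R norm v)"

lemma homogeneous_extension_0 [simp]: "homogeneous_extension g 0 = 0"
  by (simp add: homogeneous_extension_def)

lemma homogeneous_extension_unit: "norm x = 1 \<Longrightarrow> homogeneous_extension g x = g x"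
  by (simp add: homogeneous_extension_def)

lemma homogeneous_extension_scaleR:
  "c \<ge> 0 \<Longrightarrow> homogeneous_extension g (c *\<^sub>R v) = c * homogeneous_extension g v"
  by (cases "c = 0") (simp_all add: homogeneous_extension_def field_simps)

text \<open>The directions of \<open>u\<close> and \<open>v\<close>, weighted by the share of their lengths in
  \<open>norm u + norm v\<close>, combine to a positive multiple of \<open>u + v\<close>, so sublinearity on the sphere
  applies to them. When \<open>u + v = 0\<close> there is no combined direction, and the separate condition on
  antipodal points takes over.\<close>

lemma homogeneous_extension_add_le:
  assumes "sublinear_on_sphere g"
  shows "homogeneous_extension g (u + v) \<le> homogeneous_extension g u + homogeneous_extension g v"
proof (cases "u = 0 \<or> v = 0")
  case True
  then show ?thesis by auto
next
  case False
  define x y c where "x = u /\<^sub>R norm u" and "y = v /\<^sub>R norm v"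
    and "c = norm u / (norm u + norm v)"
  have pos: "norm u > 0" "norm v > 0" "norm u + norm v > 0"
    using False by (auto intro: add_pos_pos)
  have xy: "x \<in> sphere 0 1" "y \<in> sphere 0 1" using pos by (auto simp: x_def y_def)
  have c: "c \<in> {0..1}" "1 - c = norm v / (norm u + norm v)"
    using pos by (auto simp: c_def field_simps)
  have cx: "c *\<^sub>R x = u /\<^sub>R (norm u + norm v)" and cy: "(1 - c) *\<^sub>R y = v /\<^sub>R (norm u + norm v)"
    using pos by (simp_all add: c(2)) (simp_all add: c_def x_def y_def divide_inverse)
  then have z: "c *\<^sub>R x + (1 - c) *\<^sub>R y = (u + v) /\<^sub>R (norm u + norm v)"
    by (simp add: scaleR_right_distrib)
  show ?thesis
  proof (cases "u + v = 0")
    case True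
    then have "v = - u" by (simp add: eq_neg_iff_add_eq_0 add.commute)
    moreover have "0 \<le> g x + g (- x)" using assms xy(1) by (simp add: sublinear_on_sphere_def)
    ultimately show ?thesis
      using pos mult_nonneg_nonneg[of "norm u" "g x + g (- x)"]
      by (simp add: homogeneous_extension_def x_def algebra_simps)
  next
    case False
    let ?s = "norm u + norm v"
    have nz: "norm ((u + v) /\<^sub>R ?s) = norm (u + v) / ?s"
      using pos by (simp add: divide_inverse mult.commute)
    have dir: "((u + v) /\<^sub>R ?s) /\<^sub>R norm ((u + v) /\<^sub>R ?s) = (u + v) /\<^sub>R norm (u + v)"
      unfolding nz using pos by (simp add: field_simps)
    have "(u + v) /\<^sub>R ?s \<noteq> 0" using pos False by simp
    then have "g ((u + v) /\<^sub>R norm (u + v)) \<le> (c * g x + (1 - c) * g y) / (norm (u + v) / ?s)"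
      using assms xy c(1) unfolding sublinear_on_sphere_def z[symmetric] dir[symmetric] nz[symmetric]
      by blast
    also have "\<dots> = (norm u * g x + norm v * g y) / norm (u + v)"
    proof -
      have "c * g x + (1 - c) * g y = (norm u * g x + norm v * g y) / ?s"
        unfolding c(2) by (simp add: c_def add_divide_distrib)
      then show ?thesis using pos by simp
    qed
    finally show ?thesis
      using False by (simp add: homogeneous_extension_def x_def y_def field_simps)
  qed
qed

text \<open>A subgradient \<open>t\<close> of the homogeneous extension at \<open>x\<close> supports its graph along the whole ray
  through \<open>x\<close>, hence \<open>t \<bullet> x = g x\<close>; the subgradient inequality then says that \<open>t\<close> lies below the
  extension everywhere.\<close>

lemma wulff_shape_touches:
  fixes g :: "real ^ 'n \<Rightarrow> real"
  assumes g: "sublinear_on_sphere g" and x: "norm x = 1"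
  obtains t where "t \<in> wulff_shape g" "t \<bullet> x = g x"
proof -
  let ?G = "homogeneous_extension g"
  have "convex_on UNIV ?G"
  proof (rule convex_onI)
    fix c :: real and u v :: "real ^ 'n"
    assume "0 < c" "c < 1"
    then show "?G ((1 - c) *\<^sub>R u + c *\<^sub>R v) \<le> (1 - c) * ?G u + c * ?G v"
      using homogeneous_extension_add_le[OF g, of "(1 - c) *\<^sub>R u" "c *\<^sub>R v"]
      by (simp add: homogeneous_extension_scaleR)
  qed simp
  then obtain t where t: "\<And>y. ?G x + t \<bullet> (y - x) \<le> ?G y"
    using convex_on_imp_subgradient by blast
  \<comment> \<open>The points \<open>0\<close> and \<open>2 *\<^sub>R x\<close> lie on either side of \<open>x\<close> on its ray.\<close>
  have "?G x \<le> t \<bullet> x" "t \<bullet> x \<le> ?G x"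
    using t[of 0] t[of "2 *\<^sub>R x"] homogeneous_extension_scaleR[of 2 g x]
    by (simp_all add: inner_diff_right)
  then have tx: "t \<bullet> x = ?G x" by simp
  have "t \<bullet> y \<le> g y" if "norm y = 1" for y
    using t[of y] by (simp add: tx inner_diff_right homogeneous_extension_unit that)
  then show thesis
    using that tx x by (auto intro: wulff_shapeI simp: homogeneous_extension_unit)
qed

lemma wulff_shape_nonempty:
  fixes g :: "real ^ 'n \<Rightarrow> real"
  assumes "sublinear_on_sphere g"
  shows "wulff_shape g \<noteq> {}"
  using wulff_shape_touches[OF assms, of "axis undefined 1"] by (auto simp: norm_axis_1)

lemma support_wulff_shape:
  fixes g :: "real ^ 'n \<Rightarrow> real"
  assumes "sublinear_on_sphere g" "norm x = 1"
  shows "(SUP t\<in>wulff_shape g. t \<bullet> x) = g x"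
proof (rule cSup_eq_maximum)
  show "g x \<in> (\<lambda>t. t \<bullet> x) ` wulff_shape g"
    using wulff_shape_touches[OF assms] by (metis image_eqI)
qed (use wulff_shapeD assms(2) in blast)

section \<open>One-sided limits of monotone functions\<close>

text \<open>For a monotone function one-sided continuity is a statement about a single point nearby,
  because every point in between is controlled by it.\<close>

lemma antimono_on_left_continuousI:
  fixes f :: "real \<Rightarrow> real"
  assumes "antimono_on {a..b} f" "\<alpha> \<in> {a<..b}"
    and approx: "\<And>e. e > 0 \<Longrightarrow> \<exists>\<beta>\<in>{a..<\<alpha>}. f \<beta> < f \<alpha> + e"
  shows "continuous (at_left \<alpha>) f"
  unfolding continuous_within
proof (rule order_tendstoI)
  fix l assume "l < f \<alpha>"
  have "eventually (\<lambda>\<gamma>. \<gamma> \<in> {a<..<\<alpha>}) (at_left \<alpha>)"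
    using assms(2) by (intro eventually_at_leftI) auto
  then show "eventually (\<lambda>\<gamma>. l < f \<gamma>) (at_left \<alpha>)"
  proof eventually_elim
    case (elim \<gamma>)
    then show ?case
      using \<open>l < f \<alpha>\<close> assms(2) monotone_onD[OF assms(1), of \<gamma> \<alpha>] by auto
  qed
next
  fix r assume "f \<alpha> < r"
  then obtain \<beta> where \<beta>: "\<beta> \<in> {a..<\<alpha>}" "f \<beta> < r"
    using approx[of "r - f \<alpha>"] by auto
  have "eventually (\<lambda>\<gamma>. \<gamma> \<in> {\<beta><..<\<alpha>}) (at_left \<alpha>)"
    using \<beta>(1) by (intro eventually_at_leftI) auto
  then show "eventually (\<lambda>\<gamma>. f \<gamma> < r) (at_left \<alpha>)"
  proof eventually_elim
    case (elim \<gamma>)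
    then show ?case using \<beta> assms(2) monotone_onD[OF assms(1), of \<beta> \<gamma>] by auto
  qed
qed

lemma antimono_on_right_continuousI:
  fixes f :: "real \<Rightarrow> real"
  assumes "antimono_on {a..b} f"
    and approx: "\<And>e. e > 0 \<Longrightarrow> \<exists>\<beta>\<in>{a<..b}. f \<beta> > f a - e"
  shows "continuous (at_right a) f"
  unfolding continuous_within
proof (rule order_tendstoI)
  fix l assume "l < f a"
  then obtain \<beta> where \<beta>: "\<beta> \<in> {a<..b}" "l < f \<beta>"
    using approx[of "f a - l"] by auto
  have "eventually (\<lambda>\<gamma>. \<gamma> \<in> {a<..<\<beta>}) (at_right a)"
    using \<beta>(1) by (intro eventually_at_rightI) auto
  then show "eventually (\<lambda>\<gamma>. l < f \<gamma>) (at_right a)"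
  proof eventually_elim
    case (elim \<gamma>)
    then show ?case using \<beta> monotone_onD[OF assms(1), of \<gamma> \<beta>] by auto
  qed
next
  fix r assume r: "f a < r"
  obtain b' where b': "b' \<in> {a<..b}" using approx[of 1] by auto
  have "eventually (\<lambda>\<gamma>. \<gamma> \<in> {a<..<b'}) (at_right a)"
    using b' by (intro eventually_at_rightI) auto
  then show "eventually (\<lambda>\<gamma>. f \<gamma> < r) (at_right a)"
  proof eventually_elim
    case (elim \<gamma>)
    then show ?case using r b' monotone_onD[OF assms(1), of a \<gamma>] by auto
  qed
qed

section \<open>From fuzzy vectors to their support functions\<close>

lemma level_set_antimono:
  assumes "fuzzy_vector u" "0 \<le> \<alpha>" "\<alpha> \<le> \<beta>"
  shows "level_set u \<beta> \<subseteq> level_set u \<alpha>"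
  using assms closure_subset[of "{t. 0 < u t}"] by (auto simp: level_set_def)

lemma level_set_nonempty:
  assumes "fuzzy_vector u" "\<alpha> \<in> {0..1}"
  shows "level_set u \<alpha> \<noteq> {}"
proof -
  obtain t where "u t = 1" using assms(1) by (auto simp: fuzzy_vector_def)
  then have "t \<in> level_set u 1" by (simp add: level_set_def)
  then show ?thesis using level_set_antimono[OF assms(1), of \<alpha> 1] assms(2) by auto
qed

lemma compact_level_set:
  assumes "fuzzy_vector u" "\<alpha> \<in> {0..1}"
  shows "compact (level_set u \<alpha>)"
proof -
  have "compact (level_set u 0)" "closed (level_set u \<alpha>)"
    using assms by (auto simp: level_set_def fuzzy_vector_def)
  moreover have "level_set u \<alpha> = level_set u 0 \<inter> level_set u \<alpha>"
    using level_set_antimono[OF assms(1), of 0 \<alpha>] assms(2) by auto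
  ultimately show ?thesis by (metis compact_Int_closed)
qed

lemma convex_level_set:
  assumes "fuzzy_vector u"
  shows "convex (level_set u \<alpha>)"
proof -
  have V3: "min (u s) (u t) \<le> u (a *\<^sub>R s + b *\<^sub>R t)" if "a \<ge> 0" "b \<ge> 0" "a + b = 1" for s t a b
  proof -
    have "b = 1 - a" "a \<in> {0..1}" using that by auto
    then show ?thesis using assms by (simp add: fuzzy_vector_def)
  qed
  have "convex {t. 0 < u t}"
  proof (rule convexI)
    show "a *\<^sub>R s + b *\<^sub>R t \<in> {t. 0 < u t}"
      if "s \<in> {t. 0 < u t}" "t \<in> {t. 0 < u t}" "0 \<le> a" "0 \<le> b" "a + b = 1" for s t a b
      using V3[OF that(3-5), of s t] that(1,2) by auto
  qed
  moreover have "convex {t. \<alpha> \<le> u t}"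
  proof (rule convexI)
    show "a *\<^sub>R s + b *\<^sub>R t \<in> {t. \<alpha> \<le> u t}"
      if "s \<in> {t. \<alpha> \<le> u t}" "t \<in> {t. \<alpha> \<le> u t}" "0 \<le> a" "0 \<le> b" "a + b = 1" for s t a b
      using V3[OF that(3-5), of s t] that(1,2) by auto
  qed
  ultimately show ?thesis by (simp add: level_set_def convex_closure)
qed

lemma bounded_level_set: "fuzzy_vector u \<Longrightarrow> \<alpha> \<in> {0..1} \<Longrightarrow> bounded (level_set u \<alpha>)"
  by (simp add: compact_level_set compact_imp_bounded)

lemma support_function_upper:
  assumes "fuzzy_vector u" "\<alpha> \<in> {0..1}" "t \<in> level_set u \<alpha>"
  shows "t \<bullet> x \<le> support_function u \<alpha> x"
  unfolding support_function_def
  by (intro cSUP_upper bdd_above_inner_image bounded_level_set assms)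

lemma support_function_antimono:
  assumes "fuzzy_vector u"
  shows "antimono_on {0..1} (\<lambda>\<alpha>. support_function u \<alpha> x)"
proof (rule monotone_onI)
  fix \<alpha> \<beta> :: real assume "\<alpha> \<in> {0..1}" "\<beta> \<in> {0..1}" "\<alpha> \<le> \<beta>"
  then show "support_function u \<beta> x \<le> support_function u \<alpha> x"
    unfolding support_function_def
    by (intro cSUP_subset_mono level_set_nonempty level_set_antimono bdd_above_inner_image
        bounded_level_set assms) auto
qed

text \<open>If the support function stayed \<open>e\<close> above its value at \<open>\<alpha>\<close>, then the parts of the level sets
  below \<open>\<alpha>\<close> that lie in a half-space slightly beyond the value at \<open>\<alpha>\<close> would be nonempty, compact
  and nested. A common point belongs to the level set at \<open>\<alpha>\<close>, yet exceeds its support function.\<close>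

lemma support_function_left_continuous:
  assumes u: "fuzzy_vector u" and \<alpha>: "\<alpha> \<in> {0<..1}"
  shows "continuous (at_left \<alpha>) (\<lambda>\<beta>. support_function u \<beta> x)"
proof (rule antimono_on_left_continuousI[OF support_function_antimono[OF u] \<alpha>], rule ccontr)
  fix e :: real
  assume "e > 0" and far: "\<not> (\<exists>\<beta>\<in>{0..<\<alpha>}. support_function u \<beta> x < support_function u \<alpha> x + e)"
  define m where "m = support_function u \<alpha> x"
  define K where "K \<beta> = level_set u \<beta> \<inter> {t. x \<bullet> t \<ge> m + e / 2}" for \<beta>
  have K_ne: "K \<beta> \<noteq> {}" if "\<beta> \<in> {0..<\<alpha>}" for \<beta>
  proof
    assume "K \<beta> = {}"
    then have "support_function u \<beta> x \<le> m + e / 2"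
      unfolding support_function_def
      using that \<alpha> u level_set_nonempty[OF u, of \<beta>]
      by (intro cSUP_least) (auto simp: K_def inner_commute not_le intro: less_imp_le)
    then show False using far that \<open>e > 0\<close> by (force simp: m_def)
  qed
  have K_compact: "compact (K \<beta>)" if "\<beta> \<in> {0..<\<alpha>}" for \<beta>
    using that \<alpha> u unfolding K_def
    by (intro compact_Int_closed compact_level_set closed_halfspace_ge) auto
  \<comment> \<open>Finitely many of these sets contain the one of the largest index; inserting \<open>0\<close> covers the
    empty subfamily.\<close>
  have "K 0 \<inter> (\<Inter>\<beta>\<in>{0..<\<alpha>}. K \<beta>) \<noteq> {}"
  proof (rule compact_imp_fip_image)
    show "compact (K 0)" using \<alpha> by (intro K_compact) auto
    show "closed (K \<beta>)" if "\<beta> \<in> {0..<\<alpha>}" for \<beta> using K_compact[OF that] by (rule compact_imp_closed)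
    fix I assume I: "finite I" "I \<subseteq> {0..<\<alpha>}"
    have top: "Max (insert 0 I) \<in> {0..<\<alpha>}"
      using I \<alpha> Max_in[of "insert 0 I"] by auto
    have "K (Max (insert 0 I)) \<subseteq> K \<beta>" if "\<beta> \<in> insert 0 I" for \<beta>
    proof -
      have "0 \<le> \<beta>" "\<beta> \<le> Max (insert 0 I)" using that I by auto
      then show ?thesis using level_set_antimono[OF u] by (auto simp: K_def)
    qed
    then show "K 0 \<inter> (\<Inter>\<beta>\<in>I. K \<beta>) \<noteq> {}" using K_ne[OF top] by blast
  qed
  then obtain t where t: "\<And>\<beta>. \<beta> \<in> {0..<\<alpha>} \<Longrightarrow> t \<in> K \<beta>" by blast
  have "\<alpha> \<le> u t"
  proof (rule dense_le_bounded[of 0])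
    show "0 < \<alpha>" using \<alpha> by simp
    show "\<beta> \<le> u t" if "0 < \<beta>" "\<beta> < \<alpha>" for \<beta>
      using t[of \<beta>] that by (simp add: K_def level_set_def)
  qed
  then have "t \<bullet> x \<le> m"
    unfolding m_def using \<alpha> by (intro support_function_upper[OF u]) (auto simp: level_set_def)
  moreover have "m + e / 2 \<le> t \<bullet> x"
    using t[of 0] \<alpha> by (simp add: K_def inner_commute)
  ultimately show False using \<open>e > 0\<close> by simp
qed

text \<open>The support function does not see the closure in the definition of the level set at \<open>0\<close>, and
  each point of positive membership already lies in a level set at a positive level, namely the one
  given by its membership.\<close>

lemma support_function_right_continuous_0:
  assumes u: "fuzzy_vector u"
  shows "continuous (at_right 0) (\<lambda>\<beta>. support_function u \<beta> x)"
proof (rule antimono_on_right_continuousI[OF support_function_antimono[OF u]], rule ccontr)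
  fix e :: real
  assume "e > 0" and far: "\<not> (\<exists>\<beta>\<in>{0<..1}. support_function u \<beta> x > support_function u 0 x - e)"
  have "x \<bullet> t \<le> support_function u 0 x - e" if "u t > 0" for t
  proof -
    have ut: "u t \<in> {0<..1}" using u that by (auto simp: fuzzy_vector_def)
    then have "t \<bullet> x \<le> support_function u (u t) x"
      by (intro support_function_upper[OF u]) (auto simp: level_set_def)
    then show ?thesis using far ut by (force simp: inner_commute)
  qed
  then have "level_set u 0 \<subseteq> {t. x \<bullet> t \<le> support_function u 0 x - e}"
    unfolding level_set_def if_P[OF refl]
    by (intro closure_minimal closed_halfspace_le) auto
  then have "(SUP t\<in>level_set u 0. t \<bullet> x) \<le> support_function u 0 x - e"
    using level_set_nonempty[OF u, of 0] by (intro cSUP_least) (auto simp: inner_commute)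
  then have "support_function u 0 x \<le> support_function u 0 x - e"
    by (simp only: support_function_def)
  then show False using \<open>e > 0\<close> by simp
qed

section \<open>Recovering a fuzzy vector from its support function\<close>

lemma level_set_eq_wulff_shape:
  assumes "fuzzy_vector u" "is_support_function_of h u" "\<alpha> \<in> {0..1}"
  shows "wulff_shape (h \<alpha>) = level_set u \<alpha>"
  using assms
  by (intro wulff_shape_support compact_imp_closed compact_level_set convex_level_set
      bounded_level_set level_set_nonempty)
    (auto simp: is_support_function_of_def support_function_def)

lemma induced_fuzzy_vector_wulff:
  "induced_fuzzy_vector h t = level_Sup {\<alpha> \<in> {0..1}. t \<in> wulff_shape (h \<alpha>)}"
  by (simp add: induced_fuzzy_vector_def wulff_shape_def)

lemma induced_fuzzy_vector_support_function:
  assumes u: "fuzzy_vector u" and h: "is_support_function_of h u"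
  shows "induced_fuzzy_vector h t = u t"
proof -
  define A where "A = {\<alpha> \<in> {0..1}. t \<in> level_set u \<alpha>}"
  have ut: "u t \<in> {0..1}" using u by (auto simp: fuzzy_vector_def)
  have A: "induced_fuzzy_vector h t = level_Sup A"
    unfolding induced_fuzzy_vector_wulff A_def
    by (intro arg_cong[of _ _ level_Sup] Collect_cong) (auto simp: level_set_eq_wulff_shape[OF u h])
  have le: "\<alpha> \<le> u t" if "\<alpha> \<in> A" for \<alpha>
    using that ut by (auto simp: A_def level_set_def split: if_splits)
  show ?thesis
  proof (cases "A = {}")
    case True
    then have "u t \<notin> A" by simp
    then have "u t = 0" using ut by (auto simp: A_def level_set_def split: if_splits)
    then show ?thesis by (simp add: A True level_Sup_def)
  next
    case False
    \<comment> \<open>At membership \<open>0\<close> the level \<open>0\<close> itself is in \<open>A\<close>, for \<open>A\<close> is nonempty and bounded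
      by \<open>u t\<close>.\<close>
    have "u t \<in> A"
    proof (cases "u t = 0")
      case True
      then show ?thesis using False le by (force simp: A_def)
    qed (use ut in \<open>auto simp: A_def level_set_def\<close>)
    then have "Sup A = u t" using le by (rule cSup_eq_maximum)
    then show ?thesis using False by (simp add: A level_Sup_def)
  qed
qed

section \<open>From sublinear families to fuzzy vectors\<close>

lemma wulff_shape_antimono:
  fixes h :: "real \<Rightarrow> real ^ 'n \<Rightarrow> real"
  assumes "VS2 h" "0 \<le> \<alpha>" "\<alpha> \<le> \<beta>" "\<beta> \<le> 1"
  shows "wulff_shape (h \<beta>) \<subseteq> wulff_shape (h \<alpha>)"
proof (intro subsetI wulff_shapeI)
  fix t x assume "t \<in> wulff_shape (h \<beta>)" and x: "norm (x :: real ^ 'n) = 1"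
  then have "t \<bullet> x \<le> h \<beta> x" by (simp add: wulff_shapeD)
  also have "\<dots> \<le> h \<alpha> x"
    using assms x by (auto simp: VS2_def dest!: bspec[of _ _ x] intro: monotone_onD[where f = "\<lambda>\<alpha>. h \<alpha> x"])
  finally show "t \<bullet> x \<le> h \<alpha> x" .
qed

lemma induced_fuzzy_vector_bounds: "induced_fuzzy_vector h t \<in> {0..1}"
proof -
  define A where "A = {\<alpha> \<in> {0..1}. t \<in> wulff_shape (h \<alpha>)}"
  have "Sup A \<in> {0..1}" if "\<alpha> \<in> A" for \<alpha>
  proof -
    have "\<alpha> \<le> Sup A" using that by (intro cSup_upper bdd_aboveI[of _ 1]) (auto simp: A_def)
    moreover have "Sup A \<le> 1" using that by (intro cSup_least) (auto simp: A_def)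
    ultimately show ?thesis using that by (auto simp: A_def)
  qed
  then show ?thesis
    unfolding induced_fuzzy_vector_wulff A_def[symmetric] level_Sup_def by auto
qed

text \<open>This is where left continuity is needed: a supremum of at least \<open>\<alpha>\<close> puts \<open>t\<close> into the Wulff
  shapes of all levels below \<open>\<alpha>\<close>, and the defining inequalities pass to the limit. The equivalence
  fails at \<open>\<alpha> = 0\<close>, where the left-hand side holds for every \<open>t\<close>.\<close>

lemma le_induced_fuzzy_vector_iff:
  fixes h :: "real \<Rightarrow> real ^ 'n \<Rightarrow> real"
  assumes h: "VS2 h" and \<alpha>: "\<alpha> \<in> {0<..1}"
  shows "\<alpha> \<le> induced_fuzzy_vector h t \<longleftrightarrow> t \<in> wulff_shape (h \<alpha>)"
proof -
  define A where "A = {\<alpha> \<in> {0..1}. t \<in> wulff_shape (h \<alpha>)}"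
  have ind: "induced_fuzzy_vector h t = level_Sup A" by (simp add: induced_fuzzy_vector_wulff A_def)
  have bdd: "bdd_above A" by (rule bdd_aboveI[of _ 1]) (simp add: A_def)
  show ?thesis
  proof
    assume "t \<in> wulff_shape (h \<alpha>)"
    then have "\<alpha> \<in> A" using \<alpha> by (simp add: A_def)
    then show "\<alpha> \<le> induced_fuzzy_vector h t"
      using cSup_upper[OF _ bdd] by (auto simp: ind level_Sup_def)
  next
    assume le: "\<alpha> \<le> induced_fuzzy_vector h t"
    then have "A \<noteq> {}" "\<alpha> \<le> Sup A" using \<alpha> by (auto simp: ind level_Sup_def split: if_splits)
    have below: "t \<in> wulff_shape (h \<beta>)" if "\<beta> \<in> {0<..<\<alpha>}" for \<beta>
    proof -
      have "\<beta> < Sup A" using that \<open>\<alpha> \<le> Sup A\<close> by simp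
      then obtain \<gamma> where "\<gamma> \<in> A" "\<beta> < \<gamma>" using less_cSupD[OF \<open>A \<noteq> {}\<close>] by blast
      then show ?thesis using wulff_shape_antimono[OF h, of \<beta> \<gamma>] that by (auto simp: A_def)
    qed
    show "t \<in> wulff_shape (h \<alpha>)"
    proof (rule wulff_shapeI)
      fix x :: "real ^ 'n" assume x: "norm x = 1"
      have "((\<lambda>\<beta>. h \<beta> x) \<longlongrightarrow> h \<alpha> x) (at_left \<alpha>)"
        using h \<alpha> x by (auto simp: VS2_def continuous_within)
      moreover have "eventually (\<lambda>\<beta>. \<beta> \<in> {0<..<\<alpha>}) (at_left \<alpha>)"
        using \<alpha> by (intro eventually_at_leftI) auto
      then have "eventually (\<lambda>\<beta>. t \<bullet> x \<le> h \<beta> x) (at_left \<alpha>)"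
        by eventually_elim (use below x in \<open>blast intro: wulff_shapeD\<close>)
      ultimately show "t \<bullet> x \<le> h \<alpha> x"
        by (rule tendsto_lowerbound) simp
    qed
  qed
qed

lemma level_set_induced_fuzzy_vector:
  assumes "VS2 h" "\<alpha> \<in> {0<..1}"
  shows "level_set (induced_fuzzy_vector h) \<alpha> = wulff_shape (h \<alpha>)"
  using assms by (auto simp: level_set_def le_induced_fuzzy_vector_iff)

lemma positive_induced_fuzzy_vector:
  assumes "VS2 h"
  shows "{t. induced_fuzzy_vector h t > 0} = (\<Union>\<alpha>\<in>{0<..1}. wulff_shape (h \<alpha>))"
proof (intro set_eqI iffI)
  fix t assume "t \<in> {t. induced_fuzzy_vector h t > 0}"
  then have "induced_fuzzy_vector h t \<in> {0<..1}"
    using induced_fuzzy_vector_bounds[of h t] by auto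
  then show "t \<in> (\<Union>\<alpha>\<in>{0<..1}. wulff_shape (h \<alpha>))"
    using le_induced_fuzzy_vector_iff[OF assms] by blast
next
  fix t assume "t \<in> (\<Union>\<alpha>\<in>{0<..1}. wulff_shape (h \<alpha>))"
  then obtain \<alpha> where "\<alpha> \<in> {0<..1}" "t \<in> wulff_shape (h \<alpha>)" by blast
  then show "t \<in> {t. induced_fuzzy_vector h t > 0}"
    using le_induced_fuzzy_vector_iff[OF assms, of \<alpha> t] by auto
qed

lemma closure_positive_subset:
  assumes "VS2 h"
  shows "closure {t. induced_fuzzy_vector h t > 0} \<subseteq> wulff_shape (h 0)"
  unfolding positive_induced_fuzzy_vector[OF assms]
  by (intro closure_minimal closed_wulff_shape UN_least wulff_shape_antimono assms) auto

text \<open>Each axiom is a property of Wulff shapes, transported by the identification of the upper level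
  sets: nonemptiness at level \<open>1\<close>, boundedness at level \<open>0\<close>, convexity and closedness.\<close>

lemma fuzzy_vector_induced:
  fixes h :: "real \<Rightarrow> real ^ 'n \<Rightarrow> real"
  assumes h: "VS1 h" "VS2 h"
  shows "fuzzy_vector (induced_fuzzy_vector h)" (is "fuzzy_vector ?u")
proof -
  have "\<exists>t. ?u t = 1"
  proof -
    obtain t where "t \<in> wulff_shape (h 1)"
      using wulff_shape_nonempty[of "h 1"] h(1) by (auto simp: VS1_def)
    then have "?u t \<ge> 1" using le_induced_fuzzy_vector_iff[OF h(2), of 1] by simp
    then have "?u t = 1" using induced_fuzzy_vector_bounds[of h t] by simp
    then show ?thesis ..
  qed
  moreover have "compact (closure {t. ?u t > 0})"
    using closure_positive_subset[OF h(2)] bounded_wulff_shape bounded_subset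
    by (auto simp: compact_eq_bounded_closed)
  moreover have "min (?u s) (?u t) \<le> ?u (c *\<^sub>R s + (1 - c) *\<^sub>R t)" if "c \<in> {0..1}" for s t c
  proof (cases "min (?u s) (?u t) > 0")
    case True
    then have m: "min (?u s) (?u t) \<in> {0<..1}"
      using induced_fuzzy_vector_bounds[of h s] by auto
    then have "s \<in> wulff_shape (h (min (?u s) (?u t)))" "t \<in> wulff_shape (h (min (?u s) (?u t)))"
      by (simp_all flip: le_induced_fuzzy_vector_iff[OF h(2)])
    then have "c *\<^sub>R s + (1 - c) *\<^sub>R t \<in> wulff_shape (h (min (?u s) (?u t)))"
      using that by (intro convexD[OF convex_wulff_shape]) auto
    then show ?thesis using le_induced_fuzzy_vector_iff[OF h(2) m] by blast
  next
    case False
    then show ?thesis using induced_fuzzy_vector_bounds[of h "c *\<^sub>R s + (1 - c) *\<^sub>R t"] by auto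
  qed
  moreover have "closed {t. \<alpha> \<le> ?u t}" if "\<alpha> \<in> {0..1}" for \<alpha>
  proof (cases "\<alpha> = 0")
    case True
    then have "{t. \<alpha> \<le> ?u t} = UNIV" using induced_fuzzy_vector_bounds[of h] by auto
    then show ?thesis by simp
  next
    case False
    then have "{t. \<alpha> \<le> ?u t} = wulff_shape (h \<alpha>)"
      using that le_induced_fuzzy_vector_iff[OF h(2), of \<alpha>] by auto
    then show ?thesis by (simp add: closed_wulff_shape)
  qed
  ultimately show ?thesis
    using induced_fuzzy_vector_bounds[of h] unfolding fuzzy_vector_def by blast
qed

text \<open>At positive levels the level sets are the Wulff shapes of \<open>h\<close>. At level \<open>0\<close>
  both sides are the limits of their values at positive levels.\<close>

lemma is_support_function_of_induced:
  fixes h :: "real \<Rightarrow> real ^ 'n \<Rightarrow> real"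
  assumes h: "VS1 h" "VS2 h"
  shows "is_support_function_of h (induced_fuzzy_vector h)"
  unfolding is_support_function_of_def
proof (intro ballI)
  let ?u = "induced_fuzzy_vector h"
  fix \<alpha> :: real and x :: "real ^ 'n"
  assume \<alpha>: "\<alpha> \<in> {0..1}" and "x \<in> sphere 0 1"
  then have x: "norm x = 1" by simp
  have pos: "support_function ?u \<beta> x = h \<beta> x" if "\<beta> \<in> {0<..1}" for \<beta>
    using that h x
    by (simp add: support_function_def level_set_induced_fuzzy_vector support_wulff_shape VS1_def)
  have "h 0 x = support_function ?u 0 x"
  proof (rule tendsto_unique)
    show "((\<lambda>\<beta>. h \<beta> x) \<longlongrightarrow> h 0 x) (at_right 0)"
      using h x by (simp add: VS2_def continuous_within)
    have "((\<lambda>\<beta>. support_function ?u \<beta> x) \<longlongrightarrow> support_function ?u 0 x) (at_right 0)"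
      using support_function_right_continuous_0[OF fuzzy_vector_induced[OF h]]
      by (simp add: continuous_within)
    moreover have "eventually (\<lambda>\<beta>. \<beta> \<in> {0<..<1::real}) (at_right 0)"
      by (intro eventually_at_rightI) auto
    then have "eventually (\<lambda>\<beta>. support_function ?u \<beta> x = h \<beta> x) (at_right 0)"
      by eventually_elim (simp add: pos)
    ultimately show "((\<lambda>\<beta>. h \<beta> x) \<longlongrightarrow> support_function ?u 0 x) (at_right 0)"
      by (rule Lim_transform_eventually)
  qed simp
  then show "h \<alpha> x = support_function ?u \<alpha> x"
    using pos[of \<alpha>] \<alpha> by (cases "\<alpha> = 0") auto
qed

section \<open>The characterization\<close>

lemma VS1_support_function:
  assumes "fuzzy_vector u" "is_support_function_of h u"
  shows "VS1 h"
  unfolding VS1_def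
proof
  fix \<alpha> :: real assume "\<alpha> \<in> {0..1}"
  then show "sublinear_on_sphere (h \<alpha>)"
    using assms by (intro sublinear_on_sphere_support[of "level_set u \<alpha>"])
      (auto simp: bounded_level_set level_set_nonempty is_support_function_of_def support_function_def)
qed

lemma VS2_support_function:
  fixes h :: "real \<Rightarrow> real ^ 'n \<Rightarrow> real"
  assumes u: "fuzzy_vector u" and h: "is_support_function_of h u"
  shows "VS2 h"
  unfolding VS2_def
proof (intro ballI conjI)
  fix x :: "real ^ 'n" assume x: "x \<in> sphere 0 1"
  have eq: "h \<beta> x = support_function u \<beta> x" if "\<beta> \<in> {0..1}" for \<beta>
    using h x that by (simp add: is_support_function_of_def)
  show "antimono_on {0..1} (\<lambda>\<alpha>. h \<alpha> x)"
    using support_function_antimono[OF u, of x] by (simp add: monotone_on_def eq)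
  show "continuous (at_left \<alpha>) (\<lambda>\<beta>. h \<beta> x)" if \<alpha>: "\<alpha> \<in> {0<..1}" for \<alpha>
  proof -
    have "eventually (\<lambda>\<beta>. \<beta> \<in> {0<..<\<alpha>}) (at_left \<alpha>)"
      using \<alpha> by (intro eventually_at_leftI) auto
    then have "eventually (\<lambda>\<beta>. h \<beta> x = support_function u \<beta> x) (at_left \<alpha>)"
      by eventually_elim (use \<alpha> eq in auto)
    then show ?thesis
      using support_function_left_continuous[OF u \<alpha>, of x] \<alpha>
      by (simp add: continuous_within eq tendsto_cong)
  qed
  have "eventually (\<lambda>\<beta>. \<beta> \<in> {0<..<1::real}) (at_right 0)"
    by (intro eventually_at_rightI) auto
  then have "eventually (\<lambda>\<beta>. h \<beta> x = support_function u \<beta> x) (at_right 0)"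
    by eventually_elim (use eq in auto)
  then show "continuous (at_right 0) (\<lambda>\<beta>. h \<beta> x)"
    using support_function_right_continuous_0[OF u, of x]
    by (simp add: continuous_within eq tendsto_cong)
qed

theorem theorem2p2p4:
  fixes h :: "real \<Rightarrow> real ^ 'n \<Rightarrow> real"
  shows "((\<exists>u. fuzzy_vector u \<and> is_support_function_of h u) \<longleftrightarrow> VS1 h \<and> VS2 h) \<and>
    (\<forall>u v. fuzzy_vector u \<and> is_support_function_of h u \<and>
           fuzzy_vector v \<and> is_support_function_of h v \<longrightarrow> u = v) \<and>
    (\<forall>u. fuzzy_vector u \<and> is_support_function_of h u \<longrightarrow>
           (\<forall>t. u t = induced_fuzzy_vector h t))"
proof -
  have recover: "u = induced_fuzzy_vector h" if "fuzzy_vector u" "is_support_function_of h u" for u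
    using induced_fuzzy_vector_support_function[OF that] by auto
  moreover have "(\<exists>u. fuzzy_vector u \<and> is_support_function_of h u) \<longleftrightarrow> VS1 h \<and> VS2 h"
    using VS1_support_function VS2_support_function fuzzy_vector_induced
      is_support_function_of_induced by blast
  ultimately show ?thesis by metis
qed

end
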